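(* Let $M$ be Hrushovski's countable non-collapsed structure for a (not necessarily symmetric) ternary relation $R$ all of whose tuples consist of distinct elements, and let $M_\sim=(M;R_\sim)$ be the reduct of $M$ to the symmetrization $$R_\sim(x_1,x_2,x_3):=\bigvee_{\sigma\in S_3}R(x_{\sigma(1)},x_{\sigma(2)},x_{\sigma(3)}).$$ Then $M_\sim$ is a proper reduct of $M$, i.e. $R$ is not definable (without parameters) in $M_\sim$.
   Context: Structures are sets with a ternary relation $R$ holding only of triples of pairwise distinct elements. For finite $A$, $d_0(A)=|A|-|R_A|$ where $R_A\subseteq A^3$ is the set of ordered triples in the relation. For finite $A\subseteq N$, $A\leqslant N$ means $d_0(B)\ge d_0(A)$ for all finite $B$ with $A\subseteq B\subseteq N$. $\mathcal{C}$ is the class of finite structures $A$ with $\emptyset\leqslant A$. $M$ is the unique (up to isomorphism) countable structure all of whose finite substructures lie in $\mathcal{C}$ and such that whenever $A\leqslant M$ is finite and $A\leqslant B\in\mathcal{C}$ there is an embedding $f:B\to M$ with $f\upharpoonright A=\mathrm{id}_A$ and $f(B)\leqslant M$. *)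

theory Defs
  imports Main "HOL-Library.Countable_Set" "HOL-Library.Infinite_Typeclass"
begin

text \<open>
  A structure is given by a carrier \<open>M\<close> together with a set \<open>R\<close> of ordered triples.  A subset
  \<open>A\<close> of \<open>M\<close> stands for the induced substructure, whose relation is \<open>induced R A\<close>.
\<close>

definition ternary_structure :: "'a set \<Rightarrow> ('a \<times> 'a \<times> 'a) set \<Rightarrow> bool" where
  "ternary_structure M R \<longleftrightarrow>
     (\<forall>x y z. (x, y, z) \<in> R \<longrightarrow>
        x \<in> M \<and> y \<in> M \<and> z \<in> M \<and> x \<noteq> y \<and> x \<noteq> z \<and> y \<noteq> z)"

definition induced :: "('a \<times> 'a \<times> 'a) set \<Rightarrow> 'a set \<Rightarrow> ('a \<times> 'a \<times> 'a) set" where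
  "induced R A = R \<inter> A \<times> A \<times> A"

definition predim :: "('a \<times> 'a \<times> 'a) set \<Rightarrow> 'a set \<Rightarrow> int" where
  "predim R A = int (card A) - int (card (induced R A))"

definition strong :: "('a \<times> 'a \<times> 'a) set \<Rightarrow> 'a set \<Rightarrow> 'a set \<Rightarrow> bool" where
  "strong R A N \<longleftrightarrow> finite A \<and> A \<subseteq> N \<and>
     (\<forall>B. finite B \<and> A \<subseteq> B \<and> B \<subseteq> N \<longrightarrow> predim R A \<le> predim R B)"

definition class_C :: "'a set \<Rightarrow> ('a \<times> 'a \<times> 'a) set \<Rightarrow> bool" where
  "class_C A R \<longleftrightarrow> finite A \<and> ternary_structure A R \<and> strong R {} A"

definition embedding ::
  "('a \<Rightarrow> 'b) \<Rightarrow> 'a set \<Rightarrow> ('a \<times> 'a \<times> 'a) set \<Rightarrow> 'b set \<Rightarrow> ('b \<times> 'b \<times> 'b) set \<Rightarrow> bool" where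
  "embedding f B S M R \<longleftrightarrow> f ` B \<subseteq> M \<and> inj_on f B \<and>
     (\<forall>x\<in>B. \<forall>y\<in>B. \<forall>z\<in>B. (x, y, z) \<in> S \<longleftrightarrow> (f x, f y, f z) \<in> R)"

text \<open>
  The extensions \<open>B\<close> of \<open>A\<close> range over structures with carrier in the same type as \<open>M\<close>.  This
  type is infinite, so every finite extension of \<open>A\<close> has a copy over \<open>A\<close> in it (over a finite type
  the extension property would be too weak).  The relation \<open>S\<close> on \<open>B\<close> is unrelated to \<open>R\<close>
  outside \<open>A\<close>, even if \<open>B\<close> meets \<open>M\<close> there.
\<close>

definition hrushovski_generic :: "'a::infinite set \<Rightarrow> ('a \<times> 'a \<times> 'a) set \<Rightarrow> bool" where
  "hrushovski_generic M R \<longleftrightarrow>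
     countable M \<and> ternary_structure M R \<and>
     (\<forall>A. finite A \<and> A \<subseteq> M \<longrightarrow> class_C A (induced R A)) \<and>
     (\<forall>A B S. strong R A M \<and> class_C B S \<and> strong S A B \<and> induced S A = induced R A \<longrightarrow>
        (\<exists>f. embedding f B S M R \<and> (\<forall>a\<in>A. f a = a) \<and> strong R (f ` B) M))"

definition symmetrization :: "('a \<times> 'a \<times> 'a) set \<Rightarrow> ('a \<times> 'a \<times> 'a) set" where
  "symmetrization R = {(x, y, z).
     (x, y, z) \<in> R \<or> (x, z, y) \<in> R \<or> (y, x, z) \<in> R \<or>
     (y, z, x) \<in> R \<or> (z, x, y) \<in> R \<or> (z, y, x) \<in> R}"

text \<open>First-order formulas with equality over one ternary relation symbol; variables are named
  by natural numbers.\<close>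

datatype fm =
    Eq nat nat
  | Rel nat nat nat
  | Neg fm
  | Conj fm fm
  | Exi nat fm

primrec fv :: "fm \<Rightarrow> nat set" where
  "fv (Eq i j) = {i, j}"
| "fv (Rel i j k) = {i, j, k}"
| "fv (Neg p) = fv p"
| "fv (Conj p q) = fv p \<union> fv q"
| "fv (Exi i p) = fv p - {i}"

primrec sat :: "'a set \<Rightarrow> ('a \<times> 'a \<times> 'a) set \<Rightarrow> (nat \<Rightarrow> 'a) \<Rightarrow> fm \<Rightarrow> bool" where
  "sat M Q v (Eq i j) \<longleftrightarrow> v i = v j"
| "sat M Q v (Rel i j k) \<longleftrightarrow> (v i, v j, v k) \<in> Q"
| "sat M Q v (Neg p) \<longleftrightarrow> \<not> sat M Q v p"
| "sat M Q v (Conj p q) \<longleftrightarrow> sat M Q v p \<and> sat M Q v q"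
| "sat M Q v (Exi i p) \<longleftrightarrow> (\<exists>a\<in>M. sat M Q (v(i := a)) p)"

text \<open>The ternary relation \<open>R\<close> on \<open>M\<close> is definable without parameters in the structure
  \<open>(M; Q)\<close>.\<close>

definition definable :: "'a set \<Rightarrow> ('a \<times> 'a \<times> 'a) set \<Rightarrow> ('a \<times> 'a \<times> 'a) set \<Rightarrow> bool" where
  "definable M Q R \<longleftrightarrow>
     (\<exists>p. fv p \<subseteq> {0, 1, 2} \<and>
        (\<forall>v. range v \<subseteq> M \<longrightarrow> ((v 0, v 1, v 2) \<in> R \<longleftrightarrow> sat M Q v p)))"

end

theory Submission
  imports Defs
begin

text \<open>
  The predimension of a set only counts related triples, so it cannot tell how a triple is
  oriented, and neither can the relation \<open>symmetrization R\<close>.  This is turned into a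
  back-and-forth argument.  Its partial maps are the bijections between finite strong subsets of
  \<open>M\<close> that preserve the predimension of every subset of their domain; they need not preserve
  \<open>R\<close>.  They do preserve the symmetrization, because a set of three elements carries a triple of
  \<open>R\<close> exactly if its predimension is less than three (\<open>predim_preserving_symmetrization\<close>).

  Such a map \<open>f\<close> on \<open>A\<close> extends to any strong \<open>B\<close> containing \<open>A\<close>: keep the relation that
  \<open>R\<close> already induces on the image of \<open>A\<close>, and copy all other triples of \<open>B\<close> literally.  All
  counts of triples are then the same as in \<open>B\<close>, so the new structure is a strong extension of the
  image of \<open>A\<close> and lies in the class \<open>\<C>\<close>; genericity realises it strongly inside \<open>M\<close>
  (\<open>predim_preserving_extend\<close>).  Since each finite set lies in a finite strong one, formulas over
  the symmetrization are invariant under these maps (\<open>sat_predim_preserving\<close>).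

  Now realise a strong three-element set in which \<open>(a, b, c)\<close> is the only triple.  Exchanging
  \<open>a\<close> and \<open>b\<close> preserves all predimensions, so no formula over the symmetrization separates
  \<open>(a, b, c)\<close> from \<open>(b, a, c)\<close>, although \<open>R\<close> does.
\<close>

section \<open>Maps that preserve predimension\<close>

text \<open>
  For finite \<open>A\<close> this says that \<open>f\<close> is injective and that every subset of \<open>A\<close> induces as many
  triples as its image.  Quantifying over the subsets keeps counts only, so that the orientation
  of a triple may change, but still locates the triples up to reordering.
\<close>

definition predim_preserving ::
  "('a \<times> 'a \<times> 'a) set \<Rightarrow> ('b \<times> 'b \<times> 'b) set \<Rightarrow> ('a \<Rightarrow> 'b) \<Rightarrow> 'a set \<Rightarrow> bool" where
  "predim_preserving R S f A \<longleftrightarrow>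
     inj_on f A \<and> (\<forall>X\<subseteq>A. predim S (f ` X) = predim R X)"

lemma predim_empty [simp]: "predim R {} = 0"
  by (simp add: predim_def induced_def)

lemma finite_induced: "finite A \<Longrightarrow> finite (induced R A)"
  by (simp add: induced_def)

lemma inj_on_map_triples:
  "inj_on f A \<Longrightarrow> inj_on (map_prod f (map_prod f f)) (induced R A)"
  by (rule inj_on_subset [of _ "A \<times> A \<times> A"]) (auto simp: induced_def intro!: map_prod_inj_on)

lemma predim_preserving_comp:
  assumes "predim_preserving R S f A" and "predim_preserving S T g (f ` A)"
  shows "predim_preserving R T (g \<circ> f) A"
  unfolding predim_preserving_def
proof (intro conjI allI impI)
  show "inj_on (g \<circ> f) A"
    using assms by (simp add: predim_preserving_def comp_inj_on)
  fix X assume X: "X \<subseteq> A"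
  then have "f ` X \<subseteq> f ` A"
    by (rule image_mono)
  then have "predim T (g ` f ` X) = predim R X"
    using assms X by (simp add: predim_preserving_def)
  then show "predim T ((g \<circ> f) ` X) = predim R X"
    by (simp only: image_comp)
qed

lemma predim_preserving_inv_into:
  assumes "predim_preserving R S f A"
  shows "predim_preserving S R (inv_into A f) (f ` A)"
  unfolding predim_preserving_def
proof (intro conjI allI impI)
  have inj: "inj_on f A"
    using assms by (simp add: predim_preserving_def)
  show "inj_on (inv_into A f) (f ` A)"
    by (simp add: inj_on_inv_into)
  fix Y assume "Y \<subseteq> f ` A"
  then obtain X where X: "X \<subseteq> A" "Y = f ` X"
    by (auto simp: subset_image_iff)
  then have "inv_into A f ` Y = X"
    using inj by (simp add: inv_into_image_cancel)
  then show "predim R (inv_into A f ` Y) = predim S Y"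
    using assms X by (simp add: predim_preserving_def)
qed

lemma strong_image:
  assumes f: "predim_preserving R S f B" and A: "strong R A B"
  shows "strong S (f ` A) (f ` B)"
  unfolding strong_def
proof (intro conjI allI impI)
  show "finite (f ` A)" "f ` A \<subseteq> f ` B"
    using A by (auto simp: strong_def)
  fix Y assume Y: "finite Y \<and> f ` A \<subseteq> Y \<and> Y \<subseteq> f ` B"
  then obtain X where X: "X \<subseteq> B" "Y = f ` X"
    by (auto simp: subset_image_iff)
  have inj: "inj_on f B"
    using f by (simp add: predim_preserving_def)
  have "finite X"
    using Y X inj by (metis finite_imageD inj_on_subset)
  moreover have "A \<subseteq> X"
  proof
    fix a assume "a \<in> A"
    then have "f a \<in> f ` X" "a \<in> B"
      using Y X A by (auto simp: strong_def)
    then show "a \<in> X"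
      using inj X by (simp add: inj_on_image_mem_iff)
  qed
  ultimately have "predim R A \<le> predim R X"
    using A X by (simp add: strong_def)
  moreover have "A \<subseteq> B"
    using A by (simp add: strong_def)
  ultimately show "predim S (f ` A) \<le> predim S Y"
    using f X by (simp add: predim_preserving_def)
qed

lemma embedding_predim_preserving:
  assumes "embedding f B S M R"
  shows "predim_preserving S R f B"
  unfolding predim_preserving_def
proof (intro conjI allI impI)
  show inj: "inj_on f B"
    using assms by (simp add: embedding_def)
  fix X assume X: "X \<subseteq> B"
  let ?F = "map_prod f (map_prod f f)"
  have "induced R (f ` X) = ?F ` induced S X"
  proof (intro set_eqI iffI)
    fix t assume "t \<in> induced R (f ` X)"
    then obtain x y z where "x \<in> X" "y \<in> X" "z \<in> X" "t = ?F (x, y, z)" "t \<in> R"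
      by (auto simp: induced_def)
    moreover from this have "(x, y, z) \<in> induced S X"
      using assms subsetD [OF X] by (simp add: embedding_def induced_def)
    ultimately show "t \<in> ?F ` induced S X"
      by blast
  next
    fix t assume "t \<in> ?F ` induced S X"
    then show "t \<in> induced R (f ` X)"
      using assms subsetD [OF X] by (auto simp: embedding_def induced_def)
  qed
  moreover have "inj_on f X"
    using inj X by (rule inj_on_subset)
  moreover from this have "inj_on ?F (induced S X)"
    by (rule inj_on_map_triples)
  ultimately show "predim R (f ` X) = predim S X"
    by (simp add: predim_def card_image)
qed

text \<open>
  If \<open>x\<close>, \<open>y\<close>, \<open>z\<close> are distinct, the triples that \<open>R\<close> induces on \<open>{x, y, z}\<close> are the
  reorderings of \<open>(x, y, z)\<close> in \<open>R\<close>, so the right-hand side says that there is one.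
\<close>

lemma symmetrization_iff_predim:
  assumes "ternary_structure M R"
  shows "(x, y, z) \<in> symmetrization R \<longleftrightarrow>
    x \<noteq> y \<and> x \<noteq> z \<and> y \<noteq> z \<and> predim R {x, y, z} < 3"
proof (cases "x \<noteq> y \<and> x \<noteq> z \<and> y \<noteq> z")
  case True
  have dist: "u \<noteq> v \<and> u \<noteq> w \<and> v \<noteq> w" if "(u, v, w) \<in> R" for u v w
    using assms that by (auto simp: ternary_structure_def)
  have "predim R {x, y, z} < 3 \<longleftrightarrow> induced R {x, y, z} \<noteq> {}"
    using True finite_induced [of "{x, y, z}" R]
    by (simp add: predim_def card_gt_0_iff)
  also have "\<dots> \<longleftrightarrow> (x, y, z) \<in> symmetrization R"
  proof
    assume "induced R {x, y, z} \<noteq> {}"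
    then obtain u v w where "(u, v, w) \<in> R" "u \<in> {x, y, z}" "v \<in> {x, y, z}" "w \<in> {x, y, z}"
      by (auto simp: induced_def)
    then show "(x, y, z) \<in> symmetrization R"
      using dist [of u v w] by (auto simp: symmetrization_def)
  qed (auto simp: symmetrization_def induced_def)
  finally show ?thesis
    using True by simp
next
  case False
  then show ?thesis
    using assms by (auto simp: symmetrization_def ternary_structure_def)
qed

lemma predim_preserving_symmetrization:
  assumes "ternary_structure M R" "ternary_structure N S" "predim_preserving R S f A"
    and xyz: "x \<in> A" "y \<in> A" "z \<in> A"
  shows "(f x, f y, f z) \<in> symmetrization S \<longleftrightarrow> (x, y, z) \<in> symmetrization R"
proof -
  have "f x = f y \<longleftrightarrow> x = y" "f x = f z \<longleftrightarrow> x = z" "f y = f z \<longleftrightarrow> y = z"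
    using assms(3) xyz by (auto simp: predim_preserving_def inj_on_eq_iff)
  moreover have "predim S (f ` {x, y, z}) = predim R {x, y, z}"
    using assms(3) xyz by (simp add: predim_preserving_def del: image_insert)
  ultimately show ?thesis
    using symmetrization_iff_predim [OF assms(1)] symmetrization_iff_predim [OF assms(2)]
    by simp
qed

section \<open>Strong sets and genericity\<close>

text \<open>
  Predimensions are nonnegative integers, so among the finite sets between \<open>X\<close> and \<open>M\<close> there is
  one of least predimension, and it is strong.
\<close>

lemma strong_superset_exists:
  assumes nonneg: "\<And>A. finite A \<Longrightarrow> A \<subseteq> M \<Longrightarrow> 0 \<le> predim R A"
    and X: "finite X" "X \<subseteq> M"
  obtains B where "X \<subseteq> B" "strong R B M"
proof -
  let ?P = "\<lambda>B. finite B \<and> X \<subseteq> B \<and> B \<subseteq> M"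
  obtain B where B: "?P B" and least: "\<And>C. ?P C \<Longrightarrow> nat (predim R B) \<le> nat (predim R C)"
    using ex_has_least_nat [of ?P X "\<lambda>B. nat (predim R B)"] X by auto
  have "predim R B \<le> predim R C" if "finite C" "B \<subseteq> C" "C \<subseteq> M" for C
  proof -
    have "X \<subseteq> C"
      using B that by blast
    then have "nat (predim R B) \<le> nat (predim R C)"
      using least that by blast
    then show ?thesis
      using nonneg [of C] that by linarith
  qed
  then have "strong R B M"
    using B by (simp add: strong_def)
  then show thesis
    using B that by blast
qed

lemma generic_predim_nonneg:
  assumes "hrushovski_generic M R" "finite A" "A \<subseteq> M"
  shows "0 \<le> predim R A"
proof -
  have "strong (induced R A) {} A"
    using assms by (simp add: hrushovski_generic_def class_C_def)
  then have "0 \<le> predim (induced R A) A"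
    using assms(2) by (auto simp: strong_def)
  then show ?thesis
    by (simp add: predim_def induced_def Int_assoc)
qed

lemma generic_extension:
  assumes gen: "hrushovski_generic M R" and "strong R A M" "class_C B S" "strong S A B"
    and "induced S A = induced R A"
  obtains f where "embedding f B S M R" "\<forall>a\<in>A. f a = a" "strong R (f ` B) M"
proof -
  have "\<forall>A B S. strong R A M \<and> class_C B S \<and> strong S A B \<and> induced S A = induced R A \<longrightarrow>
      (\<exists>f. embedding f B S M R \<and> (\<forall>a\<in>A. f a = a) \<and> strong R (f ` B) M)"
    using gen by (simp add: hrushovski_generic_def)
  from this [THEN spec, of A, THEN spec, of B, THEN spec, of S]
  have "\<exists>f. embedding f B S M R \<and> (\<forall>a\<in>A. f a = a) \<and> strong R (f ` B) M"
    using assms(2-) by simp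
  then show thesis
    using that by blast
qed

section \<open>Extending predimension-preserving maps\<close>

lemma inj_on_extend:
  fixes f :: "'a \<Rightarrow> 'b::infinite"
  assumes "finite B" "A \<subseteq> B" "inj_on f A"
  obtains h where "inj_on h B" "\<And>x. x \<in> A \<Longrightarrow> h x = f x"
proof -
  have "finite (f ` A)"
    using assms finite_subset by blast
  then have "infinite (- f ` A)"
    by (simp add: Compl_eq_Diff_UNIV infinite_UNIV)
  then obtain C where C: "finite C" "card C = card (B - A)" "C \<subseteq> - f ` A"
    using infinite_arbitrarily_large by blast
  then obtain k where k: "bij_betw k (B - A) C"
    using assms(1) finite_same_card_bij [of "B - A" C] by auto
  let ?h = "\<lambda>x. if x \<in> A then f x else k x"
  have "inj_on ?h (A \<union> (B - A))"
  proof (rule inj_on_disjoint_Un)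
    show "inj_on f A"
      by fact
    show "inj_on k (B - A)"
      using k by (rule bij_betw_imp_inj_on)
    show "f ` A \<inter> k ` (B - A) = {}"
      using k C(3) by (auto simp: bij_betw_def)
  qed
  then have "inj_on ?h B"
    using assms(2) by (simp add: Un_absorb1)
  then show thesis
    using that [of ?h] by simp
qed

text \<open>
  The copy of \<open>B\<close> keeps \<open>R'\<close> on the image of \<open>A\<close>, where it may orient triples differently from
  \<open>R\<close>, and transports the triples of \<open>R\<close> that are not contained in \<open>A\<close>.  The
  triples of \<open>R\<close> on a subset \<open>X\<close> of \<open>B\<close> split into those contained in \<open>A\<close>, which \<open>f\<close>
  preserves in number, and the others, which are copied one by one; so all counts agree.
\<close>

lemma predim_preserving_copy:
  fixes f :: "'a \<Rightarrow> 'b::infinite"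
  assumes R: "ternary_structure M R" and R': "ternary_structure N R'"
    and B: "finite B" "A \<subseteq> B" and f: "predim_preserving R R' f A"
  obtains h S where "predim_preserving R S h B" "\<And>x. x \<in> A \<Longrightarrow> h x = f x"
    "ternary_structure (h ` B) S" "induced S (f ` A) = induced R' (f ` A)"
proof -
  have "inj_on f A"
    using f by (simp add: predim_preserving_def)
  with B obtain h where inj: "inj_on h B" and hf: "\<And>x. x \<in> A \<Longrightarrow> h x = f x"
    by (rule inj_on_extend) blast
  have fh: "f ` X = h ` X" if "X \<subseteq> A" for X
    using hf that by (metis image_cong subsetD)
  let ?F = "map_prod h (map_prod h h)"
  define old where "old = induced R' (h ` A)"
  define new where "new X = ?F ` (induced R X - A \<times> A \<times> A)" for X
  define S where "S = old \<union> new B"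
  have ind: "induced S (h ` X) = induced R' (h ` (X \<inter> A)) \<union> new X" if X: "X \<subseteq> B" for X
  proof (intro set_eqI iffI)
    fix t assume t: "t \<in> induced S (h ` X)"
    then obtain x y z where xyz: "x \<in> X" "y \<in> X" "z \<in> X" "t = (h x, h y, h z)"
      by (auto simp: induced_def)
    have mem: "u \<in> A" if "h u \<in> h ` A" "u \<in> X" for u
      using inj X B that by (meson inj_on_image_mem_iff subsetD)
    from t have "t \<in> old \<or> t \<in> new B"
      by (simp add: S_def induced_def)
    then show "t \<in> induced R' (h ` (X \<inter> A)) \<union> new X"
    proof
      assume "t \<in> old"
      then have "t \<in> R'" "h x \<in> h ` A" "h y \<in> h ` A" "h z \<in> h ` A"
        unfolding old_def induced_def xyz(4) by blast+
      then have "t \<in> R'" "x \<in> A" "y \<in> A" "z \<in> A"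
        using xyz mem by blast+
      then show ?thesis
        using xyz by (simp add: induced_def)
    next
      assume "t \<in> new B"
      then obtain u where u: "u \<in> induced R B - A \<times> A \<times> A" "t = ?F u"
        unfolding new_def by (elim imageE)
      obtain x' y' z' where u_eq: "u = (x', y', z')"
        by (cases u)
      have "x' \<in> B" "y' \<in> B" "z' \<in> B" "h x' = h x" "h y' = h y" "h z' = h z"
        using u xyz(4) unfolding u_eq by (simp_all add: induced_def)
      then have "x' = x" "y' = y" "z' = z"
        using xyz subsetD [OF X] inj_onD [OF inj] by blast+
      then have "(x, y, z) \<in> induced R X - A \<times> A \<times> A"
        using u xyz unfolding u_eq by (auto simp: induced_def)
      then have "t \<in> new X"
        unfolding new_def xyz(4) by force
      then show ?thesis ..
    qed
  next
    fix t assume "t \<in> induced R' (h ` (X \<inter> A)) \<union> new X"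
    then show "t \<in> induced S (h ` X)"
      using X by (auto simp: S_def old_def new_def induced_def)
  qed
  have disj: "induced R' (h ` (X \<inter> A)) \<inter> new X = {}" if X: "X \<subseteq> B" for X
  proof -
    have mem: "u \<in> A" if "h u \<in> h ` (X \<inter> A)" "u \<in> X" for u
      using inj X that by (metis Int_iff inj_on_image_mem_iff inf.coboundedI1 subsetD)
    show ?thesis
    proof (rule equals0I)
      fix t assume t: "t \<in> induced R' (h ` (X \<inter> A)) \<inter> new X"
      then obtain u where u: "u \<in> induced R X - A \<times> A \<times> A" "t = ?F u"
        unfolding new_def by (elim IntE imageE)
      obtain x y z where u_eq: "u = (x, y, z)"
        by (cases u)
      have "h x \<in> h ` (X \<inter> A)" "h y \<in> h ` (X \<inter> A)" "h z \<in> h ` (X \<inter> A)"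
        using t unfolding u(2) u_eq induced_def by simp_all
      moreover have "x \<in> X" "y \<in> X" "z \<in> X"
        using u(1) unfolding u_eq induced_def by simp_all
      ultimately have "u \<in> A \<times> A \<times> A"
        using mem unfolding u_eq by blast
      then show False
        using u(1) by blast
    qed
  qed
  have card: "card (induced S (h ` X)) = card (induced R X)" if X: "X \<subseteq> B" for X
  proof -
    have fin: "finite X"
      using X B finite_subset by blast
    have "predim R' (f ` (X \<inter> A)) = predim R (X \<inter> A)"
      using f by (simp add: predim_preserving_def)
    moreover have "card (f ` (X \<inter> A)) = card (X \<inter> A)"
      using f by (meson card_image inf_le2 inj_on_subset predim_preserving_def)
    ultimately have "card (induced R' (h ` (X \<inter> A))) = card (induced R (X \<inter> A))"
      by (simp add: predim_def fh)
    moreover have "inj_on ?F (induced R X - A \<times> A \<times> A)"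
      using inj_on_map_triples [of h X R] inj X by (meson Diff_subset inj_on_subset)
    then have "card (new X) = card (induced R X - A \<times> A \<times> A)"
      by (simp add: new_def card_image)
    moreover have "card (induced S (h ` X)) = card (induced R' (h ` (X \<inter> A))) + card (new X)"
      unfolding ind [OF X]
      by (rule card_Un_disjoint)
        (use fin disj [OF X] in \<open>simp_all add: new_def finite_induced\<close>)
    moreover have "card (induced R X) =
        card (induced R (X \<inter> A)) + card (induced R X - A \<times> A \<times> A)"
    proof -
      have "induced R (X \<inter> A) = induced R X \<inter> A \<times> A \<times> A"
        by (auto simp: induced_def)
      then show ?thesis
        using fin by (metis card_Int_Diff finite_induced)
    qed
    ultimately show ?thesis
      by simp
  qed
  show thesis
  proof
    show "predim_preserving R S h B"
      unfolding predim_preserving_def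
    proof (intro conjI allI impI)
      fix X assume "X \<subseteq> B"
      then show "predim S (h ` X) = predim R X"
        using card inj by (metis card_image inj_on_subset predim_def)
    qed (rule inj)
    show "h x = f x" if "x \<in> A" for x
      using that by (rule hf)
    have "old \<subseteq> h ` B \<times> h ` B \<times> h ` B" "new B \<subseteq> h ` B \<times> h ` B \<times> h ` B"
      using B by (auto simp: old_def new_def induced_def)
    moreover have "x \<noteq> y \<and> x \<noteq> z \<and> y \<noteq> z" if "(x, y, z) \<in> S" for x y z
    proof -
      have "(x, y, z) \<in> R' \<or> (x, y, z) \<in> new B"
        using that by (auto simp: S_def old_def induced_def)
      then show ?thesis
      proof
        assume "(x, y, z) \<in> R'"
        then show ?thesis
          using R' unfolding ternary_structure_def by blast
      next
        assume "(x, y, z) \<in> new B"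
        then have "(x, y, z) \<in> ?F ` induced R B"
          unfolding new_def by (rule subsetD [OF image_mono, OF Diff_subset])
        then obtain u v w where uvw: "(u, v, w) \<in> R" "u \<in> B" "v \<in> B" "w \<in> B"
            and "x = h u" "y = h v" "z = h w"
          by (auto simp: induced_def)
        moreover have "u \<noteq> v" "u \<noteq> w" "v \<noteq> w"
          using R uvw(1) unfolding ternary_structure_def by blast+
        ultimately show ?thesis
          using inj by (simp add: inj_on_eq_iff)
      qed
    qed
    ultimately show "ternary_structure (h ` B) S"
      unfolding ternary_structure_def S_def by blast
    have "new A = {}"
      by (auto simp: new_def induced_def)
    then show "induced S (f ` A) = induced R' (f ` A)"
      using ind [OF B(2)] by (simp add: fh)
  qed
qed

text \<open>
  The copy of \<open>B\<close> is a strong extension of the image of \<open>A\<close>, because strength depends on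
  predimensions only.  Composing the copy map with the embedding that genericity provides gives
  the extension of \<open>f\<close>.
\<close>

lemma predim_preserving_extend:
  assumes gen: "hrushovski_generic M R"
    and fA: "strong R (f ` A) M" and f: "predim_preserving R R f A"
    and B: "strong R B M" and A: "strong R A B"
  obtains g where "predim_preserving R R g B" "strong R (g ` B) M" "\<And>x. x \<in> A \<Longrightarrow> g x = f x"
proof -
  have R: "ternary_structure M R"
    using gen by (simp add: hrushovski_generic_def)
  have fin: "finite B" "A \<subseteq> B" "B \<subseteq> M"
    using A B by (auto simp: strong_def)
  obtain h S where h: "predim_preserving R S h B" and hf: "\<And>x. x \<in> A \<Longrightarrow> h x = f x"
    and S: "ternary_structure (h ` B) S" and ind: "induced S (f ` A) = induced R (f ` A)"
    using predim_preserving_copy [OF R R fin(1,2) f] by metis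
  have "strong R {} B"
    using fin generic_predim_nonneg [OF gen] by (auto simp: strong_def)
  then have "strong S {} (h ` B)"
    using strong_image [OF h, of "{}"] by simp
  then have "class_C (h ` B) S"
    using S fin by (simp add: class_C_def)
  moreover have "f ` A = h ` A"
    using hf by (metis image_cong)
  then have "strong S (f ` A) (h ` B)"
    using strong_image [OF h A] by simp
  ultimately obtain e where e: "embedding e (h ` B) S M R" "\<forall>a\<in>f ` A. e a = a"
      and strong: "strong R (e ` h ` B) M"
    using generic_extension [OF gen fA] ind by metis
  show thesis
  proof
    show "predim_preserving R R (e \<circ> h) B"
      using predim_preserving_comp [OF h embedding_predim_preserving [OF e(1)]] .
    show "strong R ((e \<circ> h) ` B) M"
      using strong by (simp add: image_comp)
    show "(e \<circ> h) x = f x" if "x \<in> A" for x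
      using that hf e(2) by simp
  qed
qed

lemma strong_mono: "strong R A M \<Longrightarrow> A \<subseteq> B \<Longrightarrow> B \<subseteq> M \<Longrightarrow> strong R A B"
  by (auto simp: strong_def)

section \<open>Invariance of formulas over the symmetrization\<close>

text \<open>
  An induction on formulas, in which atoms are preserved by
  \<open>predim_preserving_symmetrization\<close>.  At a quantifier the map is extended to a strong set
  that contains the witness; since inverses preserve predimension too, this one step serves both
  directions of the back-and-forth.
\<close>

lemma sat_predim_preserving:
  assumes gen: "hrushovski_generic M R"
    and "strong R A M" "strong R (f ` A) M" "predim_preserving R R f A"
    and "\<And>i. i \<in> fv p \<Longrightarrow> v i \<in> A \<and> w i = f (v i)"
  shows "sat M (symmetrization R) v p \<longleftrightarrow> sat M (symmetrization R) w p"
  using assms(2-)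
proof (induction p arbitrary: A f v w)
  case (Eq i j)
  then show ?case
    by (auto simp: predim_preserving_def inj_on_eq_iff)
next
  case (Rel i j k)
  have R: "ternary_structure M R"
    using gen by (simp add: hrushovski_generic_def)
  show ?case
    using predim_preserving_symmetrization [OF R R Rel(3), of "v i" "v j" "v k"] Rel(4) by simp
next
  case (Neg p)
  show ?case
    using Neg.IH [OF Neg.prems(1-3)] Neg.prems(4) by (metis fv.simps(3) sat.simps(3))
next
  case (Conj p q)
  show ?case
    using Conj.IH(1) [OF Conj.prems(1-3), of v w] Conj.IH(2) [OF Conj.prems(1-3), of v w]
      Conj.prems(4) by simp
next
  case (Exi i p)
  have forth: "sat M (symmetrization R) v' (Exi i p) \<Longrightarrow> sat M (symmetrization R) w' (Exi i p)"
    if A: "strong R A' M" and f: "strong R (f' ` A') M" "predim_preserving R R f' A'"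
      and vw: "\<And>j. j \<in> fv (Exi i p) \<Longrightarrow> v' j \<in> A' \<and> w' j = f' (v' j)" for A' f' v' w'
  proof -
    assume "sat M (symmetrization R) v' (Exi i p)"
    then obtain a where a: "a \<in> M" "sat M (symmetrization R) (v'(i := a)) p"
      by auto
    have "finite (insert a A')" "insert a A' \<subseteq> M"
      using A a by (auto simp: strong_def)
    then obtain B where B: "insert a A' \<subseteq> B" "strong R B M"
      using strong_superset_exists [OF generic_predim_nonneg [OF gen]] by metis
    then have "strong R A' B"
      using A by (auto intro: strong_mono simp: strong_def)
    then obtain g where g: "predim_preserving R R g B" "strong R (g ` B) M"
        "\<And>x. x \<in> A' \<Longrightarrow> g x = f' x"
      using predim_preserving_extend [OF gen f B(2)] by metis
    have "(v'(i := a)) j \<in> B \<and> (w'(i := g a)) j = g ((v'(i := a)) j)" if "j \<in> fv p" for j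
      using vw [of j] g(3) B that by auto
    then have "sat M (symmetrization R) (w'(i := g a)) p"
      using Exi.IH [OF B(2) g(2,1), of "v'(i := a)" "w'(i := g a)"] a(2) by blast
    moreover have "g a \<in> M"
      using g(2) B by (auto simp: strong_def)
    ultimately show ?thesis
      by auto
  qed
  show ?case
  proof
    show "sat M (symmetrization R) w (Exi i p)" if "sat M (symmetrization R) v (Exi i p)"
      using forth [OF Exi.prems(1-3), of v w] Exi.prems(4) that by blast
    let ?f = "inv_into A f"
    have inj: "inj_on f A"
      using Exi.prems(3) by (simp add: predim_preserving_def)
    have "strong R (?f ` f ` A) M"
      using Exi.prems(1) inj by (simp add: inv_into_image_cancel)
    moreover have "w j \<in> f ` A \<and> v j = ?f (w j)" if "j \<in> fv (Exi i p)" for j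
      using Exi.prems(4) [OF that] inj by simp
    ultimately show "sat M (symmetrization R) v (Exi i p)"
      if "sat M (symmetrization R) w (Exi i p)"
      using forth [OF Exi.prems(2) _ predim_preserving_inv_into [OF Exi.prems(3)], of w v] that
      by blast
  qed
qed

section \<open>Two orientations that the symmetrization cannot separate\<close>

text \<open>
  A single triple on three points has predimension \<open>3 - 1 = 2\<close> and proper subsets have no
  triple, so this structure lies in \<open>\<C>\<close> and genericity embeds it strongly over the empty set.
\<close>

lemma generic_strong_single_triple:
  fixes M :: "'a::infinite set"
  assumes gen: "hrushovski_generic M R"
  obtains a b c where "strong R {a, b, c} M" "a \<noteq> b" "a \<noteq> c" "b \<noteq> c"
    "induced R {a, b, c} = {(a, b, c)}"
proof -
  obtain B :: "'a set" where "finite B" "card B = 3"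
    using infinite_arbitrarily_large [OF infinite_UNIV] by blast
  then obtain x y z where B: "B = {x, y, z}" and xyz: "x \<noteq> y" "x \<noteq> z" "y \<noteq> z"
    by (auto simp: card_3_iff)
  let ?S = "{(x, y, z)}"
  have "0 \<le> predim ?S X" if "X \<subseteq> B" for X
  proof (cases "(x, y, z) \<in> induced ?S X")
    case True
    then have "X = B"
      using that B by (auto simp: induced_def)
    moreover have "induced ?S B = ?S"
      by (auto simp: induced_def B)
    ultimately show ?thesis
      using \<open>card B = 3\<close> by (simp add: predim_def)
  next
    case False
    then have "induced ?S X = {}"
      by (auto simp: induced_def)
    then show ?thesis
      by (simp add: predim_def)
  qed
  then have "strong ?S {} B"
    by (simp add: strong_def)
  moreover from this have "class_C B ?S"
    using B xyz by (simp add: class_C_def ternary_structure_def)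
  moreover have "strong R {} M"
    using generic_predim_nonneg [OF gen] by (simp add: strong_def)
  moreover have "induced ?S {} = induced R {}"
    by (simp add: induced_def)
  ultimately obtain f where f: "embedding f B ?S M R" and strong: "strong R (f ` B) M"
    using generic_extension [OF gen] by metis
  have inj: "inj_on f B"
    using f by (simp add: embedding_def)
  have rel: "(f u, f v, f w) \<in> R \<longleftrightarrow> (u, v, w) = (x, y, z)" if "u \<in> B" "v \<in> B" "w \<in> B" for u v w
    using f that by (simp add: embedding_def)
  show thesis
  proof
    show "strong R {f x, f y, f z} M"
      using strong B by simp
    show "f x \<noteq> f y" "f x \<noteq> f z" "f y \<noteq> f z"
      using inj xyz B by (auto simp: inj_on_eq_iff)
    have "induced R (f ` B) = {(f x, f y, f z)}"
    proof (intro set_eqI iffI)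
      fix t assume "t \<in> induced R (f ` B)"
      then obtain u v w where "u \<in> B" "v \<in> B" "w \<in> B" "t = (f u, f v, f w)" "t \<in> R"
        by (auto simp: induced_def)
      then show "t \<in> {(f x, f y, f z)}"
        using rel [of u v w] by simp
    next
      fix t assume "t \<in> {(f x, f y, f z)}"
      then show "t \<in> induced R (f ` B)"
        using rel [of x y z] B by (simp add: induced_def)
    qed
    then show "induced R {f x, f y, f z} = {(f x, f y, f z)}"
      using B by simp
  qed
qed

theorem corollary8p13:
  fixes M :: "'a::infinite set" and R :: "('a \<times> 'a \<times> 'a) set"
  assumes "hrushovski_generic M R"
  shows "\<not> definable M (symmetrization R) R"
proof
  assume "definable M (symmetrization R) R"
  then obtain p where
    p: "\<And>v. range v \<subseteq> M \<Longrightarrow> (v 0, v 1, v 2) \<in> R \<longleftrightarrow> sat M (symmetrization R) v p"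
    by (auto simp: definable_def)
  obtain a b c where strong: "strong R {a, b, c} M"
    and abc: "a \<noteq> b" "a \<noteq> c" "b \<noteq> c" and ind: "induced R {a, b, c} = {(a, b, c)}"
    using generic_strong_single_triple [OF assms] .
  let ?A = "{a, b, c}"
  define f where "f = (\<lambda>x. if x = a then b else if x = b then a else x)"
  have fA: "f ` ?A = ?A"
    using abc by (auto simp: f_def)
  have inj: "inj_on f ?A"
    using abc by (auto simp: f_def inj_on_def)
  have "predim R (f ` X) = predim R X" if X: "X \<subseteq> ?A" for X
  proof (cases "X = ?A")
    case True
    then show ?thesis
      using fA by simp
  next
    case False
    \<comment> \<open>The only triple uses all three points, so proper subsets induce no triples.\<close>
    have no: "induced R Y = {}" if "Y \<subseteq> ?A" "Y \<noteq> ?A" for Y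
    proof -
      have "t \<notin> induced R Y" for t
      proof
        assume t: "t \<in> induced R Y"
        moreover have "induced R Y \<subseteq> induced R ?A"
          using that(1) unfolding induced_def by blast
        ultimately have "t = (a, b, c)"
          unfolding ind by blast
        then have "?A \<subseteq> Y"
          using t by (simp add: induced_def)
        then show False
          using that by blast
      qed
      then show ?thesis
        by blast
    qed
    have "f ` X \<subseteq> ?A" "f ` X \<noteq> ?A"
      using X False fA inj by (metis image_mono, metis inj_on_image_eq_iff order_refl)
    then have "induced R (f ` X) = {}" "induced R X = {}"
      using no X False by blast+
    moreover have "card (f ` X) = card X"
      using inj X by (meson card_image inj_on_subset)
    ultimately show ?thesis
      by (simp add: predim_def)
  qed
  then have pres: "predim_preserving R R f ?A"
    using inj by (simp add: predim_preserving_def)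
  define v where "v = (\<lambda>n::nat. if n = 0 then a else if n = 1 then b else c)"
  have v: "v n \<in> ?A" for n
    by (simp add: v_def)
  have "?A \<subseteq> M"
    using strong by (simp add: strong_def)
  then have "range v \<subseteq> M" "range (f \<circ> v) \<subseteq> M"
    using v fA by (blast, metis image_comp image_mono image_subsetI subset_trans)
  moreover have "sat M (symmetrization R) v p \<longleftrightarrow> sat M (symmetrization R) (f \<circ> v) p"
    using sat_predim_preserving [OF assms strong _ pres, of p v "f \<circ> v"] strong fA v by simp
  ultimately have "(v 0, v 1, v 2) \<in> R \<longleftrightarrow> ((f \<circ> v) 0, (f \<circ> v) 1, (f \<circ> v) 2) \<in> R"
    using p [of v] p [of "f \<circ> v"] by simp
  then have swap: "(a, b, c) \<in> R \<longleftrightarrow> (b, a, c) \<in> R"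
    using abc by (simp add: v_def f_def)
  have "(a, b, c) \<in> induced R ?A"
    by (simp add: ind)
  then have "(b, a, c) \<in> induced R ?A"
    using swap by (simp add: induced_def)
  then show False
    using ind abc by simp
qed

end
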